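(* Let $X$ be a set and let $Y$ be a nonempty subset of $X$. The semigroup $\overline{T}(X,Y)$ is unit-regular if and only if both of the following hold: (i) $|Y|=1$ or $Y=X$; (ii) $X$ is finite.
   Context: Maps are written on the right and composed from left to right. $T(X)$ is the semigroup of all maps $X\to X$ under composition, and $\overline{T}(X,Y)=\{f\in T(X) : Yf\subseteq Y\}$, a subsemigroup of $T(X)$ containing the identity map. An element $s$ of a semigroup $S$ with identity is unit-regular in $S$ if there is a unit $u$ of $S$ with $sus=s$; $S$ is unit-regular if all its elements are unit-regular in $S$. *)

theory Defs
  imports "HOL-Algebra.Group" "HOL-Library.FuncSet"
begin

text \<open>
  The semigroup of all maps from \<open>X\<close> to \<open>X\<close>. A map is an extensional function, so that equality
  of maps is equality on \<open>X\<close>. Maps are written on the right and composed from left to right,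
  hence the product of \<open>f\<close> and \<open>g\<close> is \<open>compose X g f\<close>, that is, first \<open>f\<close> and then \<open>g\<close>.
\<close>

definition full_transf :: "'a set \<Rightarrow> ('a \<Rightarrow> 'a) monoid" where
  "full_transf X =
     \<lparr>carrier = X \<rightarrow>\<^sub>E X, monoid.mult = (\<lambda>f g. compose X g f), one = (\<lambda>x\<in>X. x)\<rparr>"

definition transf_preserving :: "'a set \<Rightarrow> 'a set \<Rightarrow> ('a \<Rightarrow> 'a) monoid" where
  "transf_preserving X Y =
     (full_transf X)\<lparr>carrier := {f \<in> carrier (full_transf X). f ` Y \<subseteq> Y}\<rparr>"

definition unit_regular_in :: "('a, 'b) monoid_scheme \<Rightarrow> 'a \<Rightarrow> bool" where
  "unit_regular_in S s \<longleftrightarrow> (\<exists>u \<in> Units S. s \<otimes>\<^bsub>S\<^esub> u \<otimes>\<^bsub>S\<^esub> s = s)"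

definition unit_regular :: "('a, 'b) monoid_scheme \<Rightarrow> bool" where
  "unit_regular S \<longleftrightarrow> (\<forall>s \<in> carrier S. unit_regular_in S s)"

lemma monoid_full_transf: "monoid (full_transf X)"
proof (rule monoidI)
  fix f g h
  assume "f \<in> carrier (full_transf X)" and "g \<in> carrier (full_transf X)"
    and "h \<in> carrier (full_transf X)"
  then show "f \<otimes>\<^bsub>full_transf X\<^esub> g \<otimes>\<^bsub>full_transf X\<^esub> h =
      f \<otimes>\<^bsub>full_transf X\<^esub> (g \<otimes>\<^bsub>full_transf X\<^esub> h)"
    by (simp add: full_transf_def PiE_def compose_assoc[of f X X h g])
qed (auto simp: full_transf_def PiE_def compose_eq compose_Id Id_compose)

lemma monoid_transf_preserving:
  assumes "Y \<subseteq> X"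
  shows "monoid (transf_preserving X Y)"
proof -
  interpret T: monoid "full_transf X" by (rule monoid_full_transf)
  have "submonoid {f \<in> carrier (full_transf X). f ` Y \<subseteq> Y} (full_transf X)"
  proof
    show "{f \<in> carrier (full_transf X). f ` Y \<subseteq> Y} \<subseteq> carrier (full_transf X)"
      by blast
  next
    show "\<one>\<^bsub>full_transf X\<^esub> \<in> {f \<in> carrier (full_transf X). f ` Y \<subseteq> Y}"
      using T.one_closed assms by (auto simp: full_transf_def)
  next
    fix f g
    assume f: "f \<in> {f \<in> carrier (full_transf X). f ` Y \<subseteq> Y}"
      and g: "g \<in> {f \<in> carrier (full_transf X). f ` Y \<subseteq> Y}"
    have "(f \<otimes>\<^bsub>full_transf X\<^esub> g) ` Y = g ` f ` Y"
      using assms by (force simp: full_transf_def compose_def)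
    also have "\<dots> \<subseteq> Y"
      using f g by blast
    finally show "f \<otimes>\<^bsub>full_transf X\<^esub> g \<in> {f \<in> carrier (full_transf X). f ` Y \<subseteq> Y}"
      using f g by simp
  qed
  then show ?thesis
    unfolding transf_preserving_def by (rule submonoid.submonoid_is_monoid) (rule T.monoid_axioms)
qed

end

theory Submission
  imports Defs
begin

text \<open>
  A unit \<open>u\<close> with \<open>f = f u f\<close> maps every point in the range of \<open>f\<close> to a preimage of it under \<open>f\<close>,
  and it permutes both \<open>Y\<close> and \<open>X - Y\<close>. If \<open>Y \<noteq> X\<close> has two elements \<open>p\<close> and \<open>q\<close>, the map that is
  \<open>p\<close> on \<open>Y\<close> and \<open>q\<close> outside \<open>Y\<close> has no such \<open>u\<close>, because all preimages of \<open>q \<in> Y\<close> lie outside \<open>Y\<close>.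
  If \<open>X\<close> is infinite, a non-surjective injection that fixes a point of \<open>Y\<close> has no injective \<open>u\<close>.
  Conversely, for finite \<open>X\<close> a section of \<open>f\<close> on its range extends to a permutation of \<open>X\<close>, and if
  \<open>Y = {y}\<close> the section can be chosen to fix \<open>y\<close>.
\<close>

lemma carrier_transf_preserving:
  "carrier (transf_preserving X Y) = {f \<in> X \<rightarrow>\<^sub>E X. f ` Y \<subseteq> Y}"
  by (simp add: transf_preserving_def full_transf_def)

lemma mult_transf_preserving:
  "f \<otimes>\<^bsub>transf_preserving X Y\<^esub> g = compose X g f"
  by (simp add: transf_preserving_def full_transf_def)

lemma one_transf_preserving:
  "\<one>\<^bsub>transf_preserving X Y\<^esub> = (\<lambda>x\<in>X. x)"
  by (simp add: transf_preserving_def full_transf_def)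

lemmas transf_preserving_simps =
  carrier_transf_preserving mult_transf_preserving one_transf_preserving

lemma unit_transf_preserving_inj_on:
  assumes "u \<in> Units (transf_preserving X Y)"
  shows "inj_on u X"
proof -
  obtain v where v: "compose X v u = (\<lambda>x\<in>X. x)"
    using assms by (auto simp: Units_def transf_preserving_simps)
  have "v (u x) = x" if "x \<in> X" for x
    using that fun_cong[OF v, of x] by (simp add: compose_eq)
  then show ?thesis
    by (rule inj_on_inverseI)
qed

text \<open>Equality in \<open>img\<close>, not just inclusion, makes the inverse map preserve
  \<open>Y\<close> as well. Both maps are restricted to \<open>X\<close> because elements of the
  monoid are extensional.\<close>

lemma bij_betw_imp_unit_transf_preserving:
  assumes "Y \<subseteq> X" and bij: "bij_betw u X X" and img: "u ` Y = Y"
  shows "restrict u X \<in> Units (transf_preserving X Y)"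
proof -
  let ?v = "inv_into X u"
  have vu: "?v (u x) = x" if "x \<in> X" for x
    using bij that by (simp add: bij_betw_def)
  have uv: "u (?v x) = x" if "x \<in> X" for x
    using bij that by (rule bij_betw_inv_into_right)
  have "?v ` Y = ?v ` u ` Y"
    using img by simp
  also have "\<dots> = Y"
    using vu \<open>Y \<subseteq> X\<close> by (force simp: image_image)
  finally have imgv: "?v ` Y = Y" .
  have ux: "u x \<in> X" if "x \<in> X" for x
    using bij that by (rule bij_betw_apply)
  have vx: "?v x \<in> X" if "x \<in> X" for x
    using bij_betwE[OF bij_betw_inv_into[OF bij]] that by blast
  have "restrict u X \<in> carrier (transf_preserving X Y)"
    and "restrict ?v X \<in> carrier (transf_preserving X Y)"
    using assms(1) img imgv ux vx by (auto simp: carrier_transf_preserving subset_iff)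
  moreover have "compose X (restrict ?v X) (restrict u X) = (\<lambda>x\<in>X. x)"
    and "compose X (restrict u X) (restrict ?v X) = (\<lambda>x\<in>X. x)"
    using ux vx uv vu by (auto simp: compose_def fun_eq_iff)
  ultimately show ?thesis
    unfolding Units_def by (auto simp: mult_transf_preserving one_transf_preserving)
qed

lemma unit_regular_transf_preservingE:
  assumes "unit_regular (transf_preserving X Y)"
    and "f \<in> X \<rightarrow>\<^sub>E X" "f ` Y \<subseteq> Y"
  obtains u where "u \<in> Units (transf_preserving X Y)" "u \<in> X \<rightarrow> X" "u ` Y \<subseteq> Y"
    and "\<And>x. x \<in> X \<Longrightarrow> f (u (f x)) = f x"
proof -
  obtain u where u: "u \<in> Units (transf_preserving X Y)"
    and eq: "compose X f (compose X u f) = f"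
    using assms unfolding unit_regular_def unit_regular_in_def
    by (auto simp: carrier_transf_preserving mult_transf_preserving)
  have "u \<in> carrier (transf_preserving X Y)"
    using u by (simp add: Units_def)
  moreover have "f (u (f x)) = f x" if "x \<in> X" for x
    using fun_cong[OF eq, of x] that by (simp add: compose_eq)
  ultimately show thesis
    using that[OF u] by (auto simp: carrier_transf_preserving)
qed

lemma unit_regular_transf_preserving_imp_singleton_or_whole:
  assumes "Y \<noteq> {}" "Y \<subseteq> X" and reg: "unit_regular (transf_preserving X Y)"
  shows "card Y = 1 \<or> Y = X"
proof (rule ccontr)
  assume neg: "\<not> (card Y = 1 \<or> Y = X)"
  obtain p where p: "p \<in> Y"
    using assms(1) by blast
  have "Y \<noteq> {p}"
    using neg by auto
  then obtain q where q: "q \<in> Y" "q \<noteq> p"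
    using p by blast
  obtain z where z: "z \<in> X" "z \<notin> Y"
    using neg assms(2) by blast
  define f where "f = (\<lambda>x\<in>X. if x \<in> Y then p else q)"
  have "f \<in> X \<rightarrow>\<^sub>E X" "f ` Y \<subseteq> Y"
    using p q assms(2) by (auto simp: f_def)
  then obtain u where u: "u ` Y \<subseteq> Y" and fuf: "\<And>x. x \<in> X \<Longrightarrow> f (u (f x)) = f x"
    using unit_regular_transf_preservingE[OF reg] by metis
  have "u q \<in> Y"
    using u q by blast
  \<comment> \<open>Since \<open>z\<close> lies outside \<open>Y\<close>, \<open>f z = q\<close>, so
    \<open>fuf\<close> demands \<open>f (u q) = q\<close>; but \<open>f\<close> is constantly
    \<open>p\<close> on \<open>Y\<close>.\<close>
  then show False
    using fuf[of z] z q assms(2) by (auto simp: f_def)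
qed

lemma unit_regular_transf_preserving_imp_finite:
  assumes "Y \<noteq> {}" "Y \<subseteq> X" and reg: "unit_regular (transf_preserving X Y)"
    and Y: "card Y = 1 \<or> Y = X"
  shows "finite X"
proof (rule ccontr)
  assume inf: "infinite X"
  obtain y where y: "y \<in> Y"
    using assms(1) by blast
  have Y': "Y = {y} \<or> Y = X"
    using Y y by (auto simp: card_1_singleton_iff)
  have inf': "infinite (X - {y})"
    using inf by simp
  then obtain a where a: "a \<in> X - {y}"
    using infinite_imp_nonempty by blast
  \<comment> \<open>An infinite set is in bijection with itself minus a point. Removing
    \<open>y\<close> first leaves room for \<open>f\<close> to fix \<open>y\<close>, while
    \<open>a\<close> stays outside the range of \<open>f\<close>.\<close>
  obtain h where h: "bij_betw h (X - {y}) (X - {y} - {a})"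
    using infinite_imp_bij_betw[OF inf'] by blast
  have hx: "h x \<in> X - {y} - {a}" if "x \<in> X" "x \<noteq> y" for x
    using bij_betwE[OF h] that by blast
  define f where "f = (\<lambda>x\<in>X. if x = y then y else h x)"
  have fX: "f \<in> X \<rightarrow>\<^sub>E X"
    using hx y assms(2) by (auto simp: f_def)
  \<comment> \<open>The dichotomy for \<open>Y\<close> enters here: either \<open>Y\<close> is the
    fixed point alone, or there is nothing to preserve.\<close>
  have "f ` Y \<subseteq> Y"
    using Y' fX y assms(2) by (auto simp: f_def)
  with fX obtain u where u: "u \<in> Units (transf_preserving X Y)" "u \<in> X \<rightarrow> X"
    and fuf: "\<And>x. x \<in> X \<Longrightarrow> f (u (f x)) = f x"
    using unit_regular_transf_preservingE[OF reg] by metis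
  have inj_f: "inj_on f X"
  proof (rule inj_onI)
    fix v w assume vw: "v \<in> X" "w \<in> X" "f v = f w"
    show "v = w"
    \<comment> \<open>Values of \<open>h\<close> avoid \<open>y\<close>, so only \<open>y\<close>
      itself is sent to \<open>y\<close>.\<close>
    proof (cases "v = y \<or> w = y")
      case True
      then show ?thesis
        using vw hx[of v] hx[of w] by (auto simp: f_def split: if_splits)
    next
      case False
      then show ?thesis
        using vw inj_onD[OF bij_betw_imp_inj_on[OF h], of v w] by (simp add: f_def)
    qed
  qed
  \<comment> \<open>Cancelling the outer \<open>f\<close> in \<open>fuf\<close> turns
    \<open>u\<close> into a left inverse of \<open>f\<close>.\<close>
  have uf: "u (f x) = x" if "x \<in> X" for x
    using inj_onD[OF inj_f fuf[OF that]] that u(2) fX by auto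
  have ua: "u a \<in> X"
    using u(2) a by blast
  \<comment> \<open>Taking \<open>x = u a\<close> in \<open>uf\<close> gives
    \<open>u (f (u a)) = u a\<close>, and the unit \<open>u\<close> is injective. This puts
    \<open>a\<close> in the range of \<open>f\<close>.\<close>
  have "f (u a) = a"
    using inj_onD[OF unit_transf_preserving_inj_on[OF u(1)] uf[OF ua]] fX ua a by auto
  moreover have "f (u a) \<noteq> a"
    using hx[of "u a"] ua a by (auto simp: f_def)
  ultimately show False
    by contradiction
qed

text \<open>By finiteness the complements of \<open>A\<close> and of its image have equal size, so
  any bijection between them completes \<open>s\<close>.\<close>

lemma inj_on_extends_to_permutation:
  assumes "finite X" "A \<subseteq> X" "inj_on s A" "s ` A \<subseteq> X"
  obtains u where "bij_betw u X X" "\<And>x. x \<in> A \<Longrightarrow> u x = s x"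
proof -
  have "finite A"
    using assms finite_subset by blast
  then have "card (X - A) = card (X - s ` A)"
    using assms by (simp add: card_Diff_subset card_image)
  then obtain t where t: "bij_betw t (X - A) (X - s ` A)"
    using finite_same_card_bij[of "X - A" "X - s ` A"] assms(1) by auto
  define u where "u = (\<lambda>x. if x \<in> A then s x else t x)"
  have "bij_betw u A (s ` A)"
    using assms(3) bij_betw_cong[of A u s] by (simp add: u_def bij_betw_imageI)
  moreover have "bij_betw u (X - A) (X - s ` A)"
    using t bij_betw_cong[of "X - A" u t] by (simp add: u_def)
  ultimately have "bij_betw u (A \<union> (X - A)) (s ` A \<union> (X - s ` A))"
    by (rule bij_betw_combine) blast
  then have "bij_betw u X X"
    using assms(2,4) by (simp add: Un_absorb1)
  then show thesis
    by (rule that) (simp add: u_def)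
qed

lemma finite_imp_unit_regular_transf_preserving:
  assumes "Y \<noteq> {}" "Y \<subseteq> X" and Y: "card Y = 1 \<or> Y = X" and fin: "finite X"
  shows "unit_regular (transf_preserving X Y)"
  unfolding unit_regular_def
proof
  fix f
  assume "f \<in> carrier (transf_preserving X Y)"
  then have f: "f \<in> X \<rightarrow>\<^sub>E X" "f ` Y \<subseteq> Y"
    by (auto simp: carrier_transf_preserving)
  obtain y where y: "y \<in> Y"
    using assms(1) by blast
  have Y': "Y = {y} \<or> Y = X"
    using Y y by (auto simp: card_1_singleton_iff)
  \<comment> \<open>\<open>inv_into\<close> may pick another preimage of a fixed point
    \<open>y\<close>. The override keeps \<open>s\<close> a section of \<open>f\<close> on its range
    and makes \<open>s\<close>, hence the permutation extending it, fix \<open>y\<close> when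
    \<open>Y = {y}\<close>.\<close>
  define s where "s z = (if f y = y \<and> z = y then y else inv_into X f z)" for z
  have sX: "s z \<in> X" and fs: "f (s z) = z" if "z \<in> f ` X" for z
    using that y assms(2) by (auto simp: s_def inv_into_into f_inv_into_f)
  have "inj_on s (f ` X)"
    using fs by (rule inj_on_inverseI)
  then obtain u where u: "bij_betw u X X" and us: "\<And>z. z \<in> f ` X \<Longrightarrow> u z = s z"
    using inj_on_extends_to_permutation[OF fin, of "f ` X" s] sX f by blast
  have "u ` Y = Y"
    using Y'
  proof
    assume eq: "Y = {y}"
    then have "f y = y"
      using f by simp
    then have "u y = y"
      using us[of y] y assms(2) by (force simp: s_def)
    then show ?thesis
      by (simp add: eq)
  next
    assume "Y = X"
    then show ?thesis
      using u by (simp add: bij_betw_def)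
  qed
  then have "restrict u X \<in> Units (transf_preserving X Y)"
    using bij_betw_imp_unit_transf_preserving[OF assms(2) u] by blast
  moreover have "compose X f (compose X (restrict u X) f) = f"
  proof (rule extensionalityI[of _ X])
    fix x assume x: "x \<in> X"
    then have "f x \<in> X"
      using f by blast
    then show "compose X f (compose X (restrict u X) f) x = f x"
      using x us[of "f x"] fs[of "f x"] by (simp add: compose_eq)
  qed (use f in \<open>auto simp: PiE_def\<close>)
  ultimately show "unit_regular_in (transf_preserving X Y) f"
    unfolding unit_regular_in_def by (auto simp: mult_transf_preserving)
qed

theorem theorem3p4:
  fixes X Y :: "'a set"
  assumes "Y \<noteq> {}" and "Y \<subseteq> X"
  shows "unit_regular (transf_preserving X Y) \<longleftrightarrow> (card Y = 1 \<or> Y = X) \<and> finite X"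
  using unit_regular_transf_preserving_imp_singleton_or_whole[OF assms]
    unit_regular_transf_preserving_imp_finite[OF assms]
    finite_imp_unit_regular_transf_preserving[OF assms]
  by blast

end
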